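(* Let $(X,f)$ be a topological dynamical system with a metric $d\in\mathscr{D}(X)$, and let $Z$ be a non-empty subset of $X$. Suppose that $\varphi\in C(X,\mathbb{R})$ with $\varphi>0$. Then: (i) if $\overline{\mathrm{mdim}}_{M}(f,X,d)<\infty$, then $\overline{\mathrm{BSmdim}}_{M,Z,f}(\varphi,d)$ is the unique root $t\in\mathbb{R}$ of the equation $\overline{\mathrm{mdim}}_{M,Z,f}(-t\varphi,d)=0$; (ii) if $\overline{\mathrm{Pmdim}}_{M}(f,X,d)<\infty$, then $\overline{\mathrm{BSPmdim}}_{M,Z,f}(\varphi,d)$ is the unique root $t\in\mathbb{R}$ of the equation $\overline{\mathrm{Pmdim}}_{M,Z,f}(-t\varphi,d)=0$.
   Context: A topological dynamical system $(X,f)$ is a compact metrizable space $X$ with a continuous map $f:X\to X$; $\mathscr{D}(X)$ is the set of compatible metrics. $d_n(x,y)=\max_{0\le j\le n-1}d(f^jx,f^jy)$, $B_n(x,\epsilon)=\{y:d_n(x,y)<\epsilon\}$, $\overline B_n(x,\epsilon)=\{y:d_n(x,y)\le\epsilon\}$, $S_n\varphi=\sum_{i=0}^{n-1}\varphi\circ f^i$. Throughout $0<\epsilon<1$, $\lambda\in\mathbb{R}$, $N\in\mathbb{N}$, $Z\subset X$. Bowen upper metric mean dimension with potential $\phi\in C(X,\mathbb{R})$ on $Z$: let $$M(f,d,Z,\phi,\lambda,N,\epsilon)=\inf\sum_{i\in I}e^{-n_i\lambda+\log\frac1\epsilon\cdot\sup_{y\in B_{n_i}(x_i,\epsilon)}S_{n_i}\phi(y)},$$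 the infimum over all finite or countable covers $\{B_{n_i}(x_i,\epsilon)\}_{i\in I}$ of $Z$ with $n_i\ge N$; $M(f,d,Z,\phi,\lambda,\epsilon)=\lim_{N\to\infty}M(f,d,Z,\phi,\lambda,N,\epsilon)$; $\overline{\mathrm{mdim}}_{M,Z,f}(\phi,d,\epsilon)=\inf\{\lambda:M(f,d,Z,\phi,\lambda,\epsilon)=0\}=\sup\{\lambda:M(f,d,Z,\phi,\lambda,\epsilon)=\infty\}$; $\overline{\mathrm{mdim}}_{M,Z,f}(\phi,d)=\limsup_{\epsilon\to0}\overline{\mathrm{mdim}}_{M,Z,f}(\phi,d,\epsilon)/\log\frac1\epsilon$; and $\overline{\mathrm{mdim}}_M(f,Z,d)=\overline{\mathrm{mdim}}_{M,Z,f}(0,d)$. Packing upper metric mean dimension with potential $\phi$ on $Z$: let $$P(f,d,Z,\phi,\lambda,N,\epsilon)=\sup\sum_{i\in I}e^{-n_i\lambda+\log\frac1\epsilon\cdot\sup_{y\in\overline B_{n_i}(x_i,\epsilon)}S_{n_i}\phi(y)},$$ the supremum over all finite or countable pairwise disjoint families $\{\overline B_{n_i}(x_i,\epsilon)\}_{i\in I}$ with $n_i\ge N$, $x_i\in Z$; $P(f,d,Z,\phi,\lambda,\epsilon)=\lim_{N\to\infty}P(f,d,Z,\phi,\lambda,N,\epsilon)$; $\mathcal P(f,d,Z,\phi,\lambda,\epsilon)=\inf\{\sum_{i\ge1}P(f,d,Z_i,\phi,\lambda,\epsilon):\bigcup_{i\ge1}Z_i\supseteq Z\}$; $\overline{\mathrm{Pmdim}}_{M,Z,f}(\phi,d,\epsilon)=\inf\{\lambda:\mathcal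 P(f,d,Z,\phi,\lambda,\epsilon)=0\}=\sup\{\lambda:\mathcal P(f,d,Z,\phi,\lambda,\epsilon)=\infty\}$; $\overline{\mathrm{Pmdim}}_{M,Z,f}(\phi,d)=\limsup_{\epsilon\to0}\overline{\mathrm{Pmdim}}_{M,Z,f}(\phi,d,\epsilon)/\log\frac1\epsilon$; and $\overline{\mathrm{Pmdim}}_M(f,Z,d)=\overline{\mathrm{Pmdim}}_{M,Z,f}(0,d)$. BS metric mean dimension on $Z$ with respect to $\varphi>0$: let $R(f,d,\varphi,\lambda,Z,N,\epsilon)=\inf\sum_{i\in I}e^{-\lambda\sup_{y\in B_{n_i}(x_i,\epsilon)}S_{n_i}\varphi(y)}$ over all finite or countable covers $\{B_{n_i}(x_i,\epsilon)\}_{i\in I}$ of $Z$ with $n_i\ge N$; $R(f,d,\varphi,\lambda,Z,\epsilon)=\lim_{N\to\infty}R(f,d,\varphi,\lambda,Z,N,\epsilon)$; $R(f,d,\varphi,Z,\epsilon)=\inf\{\lambda:R(f,d,\varphi,\lambda,Z,\epsilon)=0\}=\sup\{\lambda:R(f,d,\varphi,\lambda,Z,\epsilon)=\infty\}$; $\overline{\mathrm{BSmdim}}_{M,Z,f}(\varphi,d)=\limsup_{\epsilon\to0}R(f,d,\varphi,Z,\epsilon)/\log\frac1\epsilon$. Packing BS metric mean dimension on $Z$ with respect to $\varphi>0$: let $P_p(f,d,\varphi,Z,\lambda,N,\epsilon)=\sup\sum_{i\in I}e^{-\lambda\sup_{y\in B_{n_i}(x_i,\epsilon)}S_{n_i}\varphi(y)}$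 over all finite or countable pairwise disjoint families $\{\overline B_{n_i}(x_i,\epsilon)\}_{i\in I}$ with $n_i\ge N$, $x_i\in Z$; $P_p(f,d,\varphi,Z,\lambda,\epsilon)=\lim_{N\to\infty}P_p(f,d,\varphi,Z,\lambda,N,\epsilon)$; $\mathcal P_p(f,d,\varphi,Z,\lambda,\epsilon)=\inf\{\sum_{i\ge1}P_p(f,d,\varphi,Z_i,\lambda,\epsilon):\bigcup_{i\ge1}Z_i\supseteq Z\}$; $\overline{\mathrm{BSPmdim}}_{M,Z,f}(\varphi,d,\epsilon)=\inf\{\lambda:\mathcal P_p(f,d,\varphi,Z,\lambda,\epsilon)=0\}=\sup\{\lambda:\mathcal P_p(f,d,\varphi,Z,\lambda,\epsilon)=\infty\}$; $\overline{\mathrm{BSPmdim}}_{M,Z,f}(\varphi,d)=\limsup_{\epsilon\to0}\overline{\mathrm{BSPmdim}}_{M,Z,f}(\varphi,d,\epsilon)/\log\frac1\epsilon$. *)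

theory Defs
  imports "HOL-Analysis.Analysis"
begin

section \<open>Topological dynamical systems\<close>

definition TDS :: "'a topology \<Rightarrow> ('a \<Rightarrow> 'a) \<Rightarrow> bool" where
  "TDS X f \<longleftrightarrow> compact_space X \<and> metrizable_space X \<and> continuous_map X X f"

definition compatible_metrics :: "'a topology \<Rightarrow> ('a \<Rightarrow> 'a \<Rightarrow> real) set" where
  "compatible_metrics X =
     {d. Metric_space (topspace X) d \<and> Metric_space.mtopology (topspace X) d = X}"

text \<open>
  From here on \<open>X\<close> is the underlying set of the space. The Bowen metric is meaningful for
  \<open>n \<ge> 1\<close> only (\<open>Max\<close> of the empty set is unspecified); the value at \<open>n = 0\<close> can only
  enter the quantities below at \<open>N = 0\<close>, and hence never their limits as \<open>N\<close> tends to infinity.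
\<close>

definition bowen_dist ::
  "('a \<Rightarrow> 'a) \<Rightarrow> ('a \<Rightarrow> 'a \<Rightarrow> real) \<Rightarrow> nat \<Rightarrow> 'a \<Rightarrow> 'a \<Rightarrow> real" where
  "bowen_dist f d n x y = Max ((\<lambda>j. d ((f ^^ j) x) ((f ^^ j) y)) ` {..<n})"

definition bowen_ball ::
  "'a set \<Rightarrow> ('a \<Rightarrow> 'a) \<Rightarrow> ('a \<Rightarrow> 'a \<Rightarrow> real) \<Rightarrow> nat \<Rightarrow> 'a \<Rightarrow> real \<Rightarrow> 'a set" where
  "bowen_ball X f d n x \<epsilon> = {y \<in> X. bowen_dist f d n x y < \<epsilon>}"

definition bowen_cball ::
  "'a set \<Rightarrow> ('a \<Rightarrow> 'a) \<Rightarrow> ('a \<Rightarrow> 'a \<Rightarrow> real) \<Rightarrow> nat \<Rightarrow> 'a \<Rightarrow> real \<Rightarrow> 'a set" where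
  "bowen_cball X f d n x \<epsilon> = {y \<in> X. bowen_dist f d n x y \<le> \<epsilon>}"

definition birkhoff_sum :: "('a \<Rightarrow> 'a) \<Rightarrow> ('a \<Rightarrow> real) \<Rightarrow> nat \<Rightarrow> 'a \<Rightarrow> real" where
  "birkhoff_sum f \<phi> n x = (\<Sum>i<n. \<phi> ((f ^^ i) x))"

text \<open>
  A finite or countable family of balls is encoded by the countable set \<open>C\<close> of its pairs
  \<open>(x\<^sub>i, n\<^sub>i)\<close>. Nothing is lost by excluding repetitions: in a cover they only increase the
  (nonnegative) sum, and in a pairwise disjoint family they cannot occur because the balls
  are nonempty.
\<close>

definition ball_covers ::
  "'a set \<Rightarrow> ('a \<Rightarrow> 'a) \<Rightarrow> ('a \<Rightarrow> 'a \<Rightarrow> real) \<Rightarrow> 'a set \<Rightarrow> nat \<Rightarrow> real \<Rightarrow> ('a \<times> nat) set set" where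
  "ball_covers X f d Z N \<epsilon> =
     {C. countable C \<and> C \<subseteq> X \<times> {N..} \<and> Z \<subseteq> (\<Union>(x, n)\<in>C. bowen_ball X f d n x \<epsilon>)}"

definition ball_packings ::
  "'a set \<Rightarrow> ('a \<Rightarrow> 'a) \<Rightarrow> ('a \<Rightarrow> 'a \<Rightarrow> real) \<Rightarrow> 'a set \<Rightarrow> nat \<Rightarrow> real \<Rightarrow> ('a \<times> nat) set set" where
  "ball_packings X f d Z N \<epsilon> =
     {C. countable C \<and> C \<subseteq> Z \<times> {N..} \<and>
         disjoint_family_on (\<lambda>(x, n). bowen_cball X f d n x \<epsilon>) C}"

definition countable_covers :: "'a set \<Rightarrow> 'a set \<Rightarrow> (nat \<Rightarrow> 'a set) set" where
  "countable_covers X Z = {Zs. (\<forall>i. Zs i \<subseteq> X) \<and> Z \<subseteq> (\<Union>i. Zs i)}"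


section \<open>Bowen upper metric mean dimension with potential\<close>

text \<open>
  Critical values are infima over real parameters, taken in the extended reals;
  the real parameter, usually written lambda, is called \<open>s\<close>.
\<close>

definition bowen_N ::
  "'a set \<Rightarrow> ('a \<Rightarrow> 'a) \<Rightarrow> ('a \<Rightarrow> 'a \<Rightarrow> real) \<Rightarrow> 'a set \<Rightarrow> ('a \<Rightarrow> real) \<Rightarrow>
    real \<Rightarrow> nat \<Rightarrow> real \<Rightarrow> ennreal" where
  "bowen_N X f d Z \<phi> s N \<epsilon> =
     (INF C\<in>ball_covers X f d Z N \<epsilon>. \<Sum>\<^sub>\<infinity>(x, n)\<in>C.
        ennreal (exp (- real n * s
          + ln (1 / \<epsilon>) * (SUP y\<in>bowen_ball X f d n x \<epsilon>. birkhoff_sum f \<phi> n y))))"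

definition bowen_outer ::
  "'a set \<Rightarrow> ('a \<Rightarrow> 'a) \<Rightarrow> ('a \<Rightarrow> 'a \<Rightarrow> real) \<Rightarrow> 'a set \<Rightarrow> ('a \<Rightarrow> real) \<Rightarrow>
    real \<Rightarrow> real \<Rightarrow> ennreal" where
  "bowen_outer X f d Z \<phi> s \<epsilon> = lim (\<lambda>N. bowen_N X f d Z \<phi> s N \<epsilon>)"

definition mdim_eps ::
  "'a set \<Rightarrow> ('a \<Rightarrow> 'a) \<Rightarrow> ('a \<Rightarrow> 'a \<Rightarrow> real) \<Rightarrow> 'a set \<Rightarrow> ('a \<Rightarrow> real) \<Rightarrow> real \<Rightarrow> ereal" where
  "mdim_eps X f d Z \<phi> \<epsilon> = (INF s\<in>{s::real. bowen_outer X f d Z \<phi> s \<epsilon> = 0}. ereal s)"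

definition mdim_pot ::
  "'a set \<Rightarrow> ('a \<Rightarrow> 'a) \<Rightarrow> ('a \<Rightarrow> 'a \<Rightarrow> real) \<Rightarrow> 'a set \<Rightarrow> ('a \<Rightarrow> real) \<Rightarrow> ereal" where
  "mdim_pot X f d Z \<phi> =
     Limsup (at_right 0) (\<lambda>\<epsilon>. mdim_eps X f d Z \<phi> \<epsilon> / ereal (ln (1 / \<epsilon>)))"

definition mdim ::
  "'a set \<Rightarrow> ('a \<Rightarrow> 'a) \<Rightarrow> ('a \<Rightarrow> 'a \<Rightarrow> real) \<Rightarrow> 'a set \<Rightarrow> ereal" where
  "mdim X f d Z = mdim_pot X f d Z (\<lambda>_. 0)"


section \<open>Packing upper metric mean dimension with potential\<close>

definition packing_N ::
  "'a set \<Rightarrow> ('a \<Rightarrow> 'a) \<Rightarrow> ('a \<Rightarrow> 'a \<Rightarrow> real) \<Rightarrow> 'a set \<Rightarrow> ('a \<Rightarrow> real) \<Rightarrow>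
    real \<Rightarrow> nat \<Rightarrow> real \<Rightarrow> ennreal" where
  "packing_N X f d Z \<phi> s N \<epsilon> =
     (SUP C\<in>ball_packings X f d Z N \<epsilon>. \<Sum>\<^sub>\<infinity>(x, n)\<in>C.
        ennreal (exp (- real n * s
          + ln (1 / \<epsilon>) * (SUP y\<in>bowen_cball X f d n x \<epsilon>. birkhoff_sum f \<phi> n y))))"

definition packing_pre ::
  "'a set \<Rightarrow> ('a \<Rightarrow> 'a) \<Rightarrow> ('a \<Rightarrow> 'a \<Rightarrow> real) \<Rightarrow> 'a set \<Rightarrow> ('a \<Rightarrow> real) \<Rightarrow>
    real \<Rightarrow> real \<Rightarrow> ennreal" where
  "packing_pre X f d Z \<phi> s \<epsilon> = lim (\<lambda>N. packing_N X f d Z \<phi> s N \<epsilon>)"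

definition packing_outer ::
  "'a set \<Rightarrow> ('a \<Rightarrow> 'a) \<Rightarrow> ('a \<Rightarrow> 'a \<Rightarrow> real) \<Rightarrow> 'a set \<Rightarrow> ('a \<Rightarrow> real) \<Rightarrow>
    real \<Rightarrow> real \<Rightarrow> ennreal" where
  "packing_outer X f d Z \<phi> s \<epsilon> =
     (INF Zs\<in>countable_covers X Z. \<Sum>i. packing_pre X f d (Zs i) \<phi> s \<epsilon>)"

definition Pmdim_eps ::
  "'a set \<Rightarrow> ('a \<Rightarrow> 'a) \<Rightarrow> ('a \<Rightarrow> 'a \<Rightarrow> real) \<Rightarrow> 'a set \<Rightarrow> ('a \<Rightarrow> real) \<Rightarrow> real \<Rightarrow> ereal" where
  "Pmdim_eps X f d Z \<phi> \<epsilon> = (INF s\<in>{s::real. packing_outer X f d Z \<phi> s \<epsilon> = 0}. ereal s)"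

definition Pmdim_pot ::
  "'a set \<Rightarrow> ('a \<Rightarrow> 'a) \<Rightarrow> ('a \<Rightarrow> 'a \<Rightarrow> real) \<Rightarrow> 'a set \<Rightarrow> ('a \<Rightarrow> real) \<Rightarrow> ereal" where
  "Pmdim_pot X f d Z \<phi> =
     Limsup (at_right 0) (\<lambda>\<epsilon>. Pmdim_eps X f d Z \<phi> \<epsilon> / ereal (ln (1 / \<epsilon>)))"

definition Pmdim ::
  "'a set \<Rightarrow> ('a \<Rightarrow> 'a) \<Rightarrow> ('a \<Rightarrow> 'a \<Rightarrow> real) \<Rightarrow> 'a set \<Rightarrow> ereal" where
  "Pmdim X f d Z = Pmdim_pot X f d Z (\<lambda>_. 0)"


section \<open>BS metric mean dimension\<close>

definition BS_N ::
  "'a set \<Rightarrow> ('a \<Rightarrow> 'a) \<Rightarrow> ('a \<Rightarrow> 'a \<Rightarrow> real) \<Rightarrow> ('a \<Rightarrow> real) \<Rightarrow> real \<Rightarrow> 'a set \<Rightarrow>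
    nat \<Rightarrow> real \<Rightarrow> ennreal" where
  "BS_N X f d \<phi> s Z N \<epsilon> =
     (INF C\<in>ball_covers X f d Z N \<epsilon>. \<Sum>\<^sub>\<infinity>(x, n)\<in>C.
        ennreal (exp (- s * (SUP y\<in>bowen_ball X f d n x \<epsilon>. birkhoff_sum f \<phi> n y))))"

definition BS_outer ::
  "'a set \<Rightarrow> ('a \<Rightarrow> 'a) \<Rightarrow> ('a \<Rightarrow> 'a \<Rightarrow> real) \<Rightarrow> ('a \<Rightarrow> real) \<Rightarrow> real \<Rightarrow> 'a set \<Rightarrow>
    real \<Rightarrow> ennreal" where
  "BS_outer X f d \<phi> s Z \<epsilon> = lim (\<lambda>N. BS_N X f d \<phi> s Z N \<epsilon>)"

definition BSmdim_eps ::
  "'a set \<Rightarrow> ('a \<Rightarrow> 'a) \<Rightarrow> ('a \<Rightarrow> 'a \<Rightarrow> real) \<Rightarrow> 'a set \<Rightarrow> ('a \<Rightarrow> real) \<Rightarrow> real \<Rightarrow> ereal" where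
  "BSmdim_eps X f d Z \<phi> \<epsilon> = (INF s\<in>{s::real. BS_outer X f d \<phi> s Z \<epsilon> = 0}. ereal s)"

definition BSmdim ::
  "'a set \<Rightarrow> ('a \<Rightarrow> 'a) \<Rightarrow> ('a \<Rightarrow> 'a \<Rightarrow> real) \<Rightarrow> 'a set \<Rightarrow> ('a \<Rightarrow> real) \<Rightarrow> ereal" where
  "BSmdim X f d Z \<phi> =
     Limsup (at_right 0) (\<lambda>\<epsilon>. BSmdim_eps X f d Z \<phi> \<epsilon> / ereal (ln (1 / \<epsilon>)))"


section \<open>Packing BS metric mean dimension\<close>

text \<open>
  The closed balls are disjoint, while the suprema of the Birkhoff sums are over open balls.
\<close>

definition BSP_N ::
  "'a set \<Rightarrow> ('a \<Rightarrow> 'a) \<Rightarrow> ('a \<Rightarrow> 'a \<Rightarrow> real) \<Rightarrow> ('a \<Rightarrow> real) \<Rightarrow> 'a set \<Rightarrow> real \<Rightarrow>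
    nat \<Rightarrow> real \<Rightarrow> ennreal" where
  "BSP_N X f d \<phi> Z s N \<epsilon> =
     (SUP C\<in>ball_packings X f d Z N \<epsilon>. \<Sum>\<^sub>\<infinity>(x, n)\<in>C.
        ennreal (exp (- s * (SUP y\<in>bowen_ball X f d n x \<epsilon>. birkhoff_sum f \<phi> n y))))"

definition BSP_pre ::
  "'a set \<Rightarrow> ('a \<Rightarrow> 'a) \<Rightarrow> ('a \<Rightarrow> 'a \<Rightarrow> real) \<Rightarrow> ('a \<Rightarrow> real) \<Rightarrow> 'a set \<Rightarrow> real \<Rightarrow>
    real \<Rightarrow> ennreal" where
  "BSP_pre X f d \<phi> Z s \<epsilon> = lim (\<lambda>N. BSP_N X f d \<phi> Z s N \<epsilon>)"

definition BSP_outer ::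
  "'a set \<Rightarrow> ('a \<Rightarrow> 'a) \<Rightarrow> ('a \<Rightarrow> 'a \<Rightarrow> real) \<Rightarrow> ('a \<Rightarrow> real) \<Rightarrow> 'a set \<Rightarrow> real \<Rightarrow>
    real \<Rightarrow> ennreal" where
  "BSP_outer X f d \<phi> Z s \<epsilon> =
     (INF Zs\<in>countable_covers X Z. \<Sum>i. BSP_pre X f d \<phi> (Zs i) s \<epsilon>)"

definition BSPmdim_eps ::
  "'a set \<Rightarrow> ('a \<Rightarrow> 'a) \<Rightarrow> ('a \<Rightarrow> 'a \<Rightarrow> real) \<Rightarrow> 'a set \<Rightarrow> ('a \<Rightarrow> real) \<Rightarrow> real \<Rightarrow> ereal" where
  "BSPmdim_eps X f d Z \<phi> \<epsilon> = (INF s\<in>{s::real. BSP_outer X f d \<phi> Z s \<epsilon> = 0}. ereal s)"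

definition BSPmdim ::
  "'a set \<Rightarrow> ('a \<Rightarrow> 'a) \<Rightarrow> ('a \<Rightarrow> 'a \<Rightarrow> real) \<Rightarrow> 'a set \<Rightarrow> ('a \<Rightarrow> real) \<Rightarrow> ereal" where
  "BSPmdim X f d Z \<phi> =
     Limsup (at_right 0) (\<lambda>\<epsilon>. BSPmdim_eps X f d Z \<phi> \<epsilon> / ereal (ln (1 / \<epsilon>)))"

end

theory Submission
  imports Defs
begin

text \<open>
  Put \<open>L = log(1/\<epsilon>)\<close>. On a Bowen ball of radius \<open>\<epsilon>\<close> the Birkhoff sum \<open>S\<^sub>n\<phi>\<close> oscillates by at most
  \<open>n\<eta>(\<epsilon>)\<close> with \<open>\<eta>(\<epsilon>) \<longrightarrow> 0\<close>, so the BS weight with parameter \<open>tL\<close> and the weight of the potential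
  \<open>-t\<phi>\<close> with parameter \<open>s\<close> are comparable up to a shift of \<open>s\<close> by \<open>o(L)\<close>. Hence the upper metric
  mean dimension \<open>G(t)\<close> of \<open>-t\<phi>\<close> is nonpositive for \<open>t\<close> above the BS dimension and nonnegative
  below it. Moreover \<open>G\<close> is finite, Lipschitz, and decreases with slope at least \<open>min \<phi> > 0\<close>, so
  the BS dimension is finite and is the only root. The argument uses only that a Caratheodory-type
  functional is monotone in its weights and does not vanish on weights \<open>\<ge> 1\<close>; this covers
  coverings and packings alike.
\<close>

section \<open>Critical exponents of a monotone functional\<close>

text \<open>In the applications \<open>\<Phi> \<epsilon>\<close> is a covering or packing functional
  at scale \<open>\<epsilon>\<close>. Both assumptions look at weights with \<open>1 \<le> n\<close>
  only: the Bowen metric is unspecified at \<open>n = 0\<close>, and the limit in \<open>N\<close>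
  discards that value.\<close>

locale critical_exponent =
  fixes \<Phi> :: "real \<Rightarrow> ('a \<times> nat \<Rightarrow> ennreal) \<Rightarrow> ennreal"
    and X :: "'a set"
  assumes mono: "\<lbrakk>\<And>x n. \<lbrakk>x \<in> X; 1 \<le> n\<rbrakk> \<Longrightarrow> w (x, n) \<le> w' (x, n)\<rbrakk> \<Longrightarrow> \<Phi> \<epsilon> w \<le> \<Phi> \<epsilon> w'"
    and nonzero: "\<lbrakk>\<And>x n. \<lbrakk>x \<in> X; 1 \<le> n\<rbrakk> \<Longrightarrow> 1 \<le> w (x, n)\<rbrakk> \<Longrightarrow> \<Phi> \<epsilon> w \<noteq> 0"
begin

text \<open>\<open>V n x\<close> stands for the supremum of the Birkhoff sums of the potential over
  the ball at \<open>(x, n)\<close>, so a potential enters only through these numbers.\<close>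

definition weight :: "real \<Rightarrow> (nat \<Rightarrow> 'a \<Rightarrow> real) \<Rightarrow> real \<Rightarrow> 'a \<times> nat \<Rightarrow> ennreal" where
  "weight \<epsilon> V s = (\<lambda>(x, n). ennreal (exp (- real n * s + ln (1 / \<epsilon>) * V n x)))"

definition crit :: "real \<Rightarrow> (nat \<Rightarrow> 'a \<Rightarrow> real) \<Rightarrow> ereal" where
  "crit \<epsilon> V = (INF s\<in>{s. \<Phi> \<epsilon> (weight \<epsilon> V s) = 0}. ereal s)"

definition BS_weight :: "(nat \<Rightarrow> 'a \<Rightarrow> real) \<Rightarrow> real \<Rightarrow> 'a \<times> nat \<Rightarrow> ennreal" where
  "BS_weight U s = (\<lambda>(x, n). ennreal (exp (- s * U n x)))"

definition BS_crit :: "real \<Rightarrow> (nat \<Rightarrow> 'a \<Rightarrow> real) \<Rightarrow> ereal" where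
  "BS_crit \<epsilon> U = (INF s\<in>{s. \<Phi> \<epsilon> (BS_weight U s) = 0}. ereal s)"

section \<open>Shift and comparison estimates for critical exponents\<close>

lemma zero_mono:
  assumes "\<Phi> \<epsilon> w' = 0" and "\<And>x n. \<lbrakk>x \<in> X; 1 \<le> n\<rbrakk> \<Longrightarrow> w (x, n) \<le> w' (x, n)"
  shows "\<Phi> \<epsilon> w = 0"
  using mono[of w w' \<epsilon>] assms by simp

text \<open>With \<open>L = ln (1 / \<epsilon>)\<close>, a summand \<open>real n * c\<close> in
  \<open>V\<close> is compensated by raising the parameter by \<open>c * L\<close>; dividing by
  \<open>L\<close> leaves the shift \<open>c\<close>, independent of
  \<open>\<epsilon>\<close>.\<close>

lemma crit_shift:
  assumes \<epsilon>: "0 < \<epsilon>" "\<epsilon> < 1"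
    and V: "\<And>x n. \<lbrakk>x \<in> X; 1 \<le> n\<rbrakk> \<Longrightarrow> V n x \<le> V' n x + real n * c"
  shows "crit \<epsilon> V / ereal (ln (1 / \<epsilon>)) \<le> crit \<epsilon> V' / ereal (ln (1 / \<epsilon>)) + ereal c"
proof -
  define L where "L = ln (1 / \<epsilon>)"
  have L: "0 < L" using \<epsilon> by (simp add: L_def)
  have "crit \<epsilon> V \<le> ereal s + ereal (c * L)" if s: "\<Phi> \<epsilon> (weight \<epsilon> V' s) = 0" for s
  proof -
    have "\<Phi> \<epsilon> (weight \<epsilon> V (s + c * L)) = 0"
    proof (rule zero_mono[OF s])
      fix x :: 'a and n :: nat assume "x \<in> X" "1 \<le> n"
      then have "L * V n x \<le> L * (V' n x + real n * c)"
        using V L by (intro mult_left_mono) auto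
      then show "weight \<epsilon> V (s + c * L) (x, n) \<le> weight \<epsilon> V' s (x, n)"
        by (simp add: weight_def L_def algebra_simps)
    qed
    then show ?thesis unfolding crit_def by (auto intro: INF_lower2)
  qed
  then have "crit \<epsilon> V - ereal (c * L) \<le> crit \<epsilon> V'"
    unfolding crit_def[of \<epsilon> V'] by (intro INF_greatest) (simp add: ereal_minus_le)
  then show ?thesis
    unfolding L_def[symmetric]
    using L by (cases "crit \<epsilon> V"; cases "crit \<epsilon> V'") (auto simp: field_simps)
qed

text \<open>For \<open>s < 0\<close> every weight \<open>exp (- real n * s)\<close> is at least 1,
  so \<open>nonzero\<close> keeps \<open>s\<close> out of the zero set.\<close>

lemma crit_nonneg:
  assumes "\<And>x n. \<lbrakk>x \<in> X; 1 \<le> n\<rbrakk> \<Longrightarrow> V n x = 0"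
  shows "0 \<le> crit \<epsilon> V"
proof -
  have "0 \<le> s" if "\<Phi> \<epsilon> (weight \<epsilon> V s) = 0" for s
  proof (rule ccontr)
    assume "\<not> 0 \<le> s"
    then have "\<Phi> \<epsilon> (weight \<epsilon> V s) \<noteq> 0"
      using assms
      by (intro nonzero) (simp add: weight_def mult_nonneg_nonpos2 mult_nonneg_nonpos flip: ennreal_1)
    with that show False by simp
  qed
  then show ?thesis unfolding crit_def by (intro INF_greatest) auto
qed

text \<open>Some zero \<open>s\<close> of the BS functional lies below \<open>L * t\<close>. Since
  \<open>U n x \<ge> 0\<close>, passing from \<open>s\<close> to \<open>L * t\<close> only lowers
  the BS weight, and the discrepancy \<open>real n * \<delta>\<close> between \<open>V\<close> and
  \<open>- t * U\<close> is paid for by the parameter \<open>\<delta> * L\<close>.\<close>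

lemma BS_crit_imp_crit:
  assumes \<epsilon>: "0 < \<epsilon>" "\<epsilon> < 1"
    and U: "\<And>x n. \<lbrakk>x \<in> X; 1 \<le> n\<rbrakk> \<Longrightarrow> 0 \<le> U n x"
    and V: "\<And>x n. \<lbrakk>x \<in> X; 1 \<le> n\<rbrakk> \<Longrightarrow> \<bar>V n x + t * U n x\<bar> \<le> real n * \<delta>"
    and less: "BS_crit \<epsilon> U / ereal (ln (1 / \<epsilon>)) < ereal t"
  shows "crit \<epsilon> V / ereal (ln (1 / \<epsilon>)) \<le> ereal \<delta>"
proof -
  define L where "L = ln (1 / \<epsilon>)"
  have L: "0 < L" using \<epsilon> by (simp add: L_def)
  have "BS_crit \<epsilon> U < ereal (L * t)"
    using less L unfolding L_def[symmetric] by (simp add: ereal_divide_less_pos)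
  then obtain s where s: "\<Phi> \<epsilon> (BS_weight U s) = 0" and st: "s < L * t"
    unfolding BS_crit_def INF_less_iff by auto
  have "\<Phi> \<epsilon> (weight \<epsilon> V (\<delta> * L)) = 0"
  proof (rule zero_mono[OF s])
    fix x :: 'a and n :: nat assume x: "x \<in> X" "1 \<le> n"
    have "L * V n x \<le> L * (real n * \<delta> - t * U n x)"
      using V[OF x] L by (intro mult_left_mono) auto
    moreover have "s * U n x \<le> L * t * U n x"
      using U[OF x] st by (intro mult_right_mono) auto
    ultimately show "weight \<epsilon> V (\<delta> * L) (x, n) \<le> BS_weight U s (x, n)"
      by (simp add: weight_def BS_weight_def L_def algebra_simps)
  qed
  then have "crit \<epsilon> V \<le> ereal (L * \<delta>)"
    unfolding crit_def by (auto intro: INF_lower2 simp: mult.commute)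
  then show ?thesis
    using L unfolding L_def[symmetric] by (simp add: ereal_divide_le_pos)
qed

text \<open>A zero \<open>s < - \<delta> * L\<close> puts a factor of at least
  \<open>exp (real n * \<delta> * L)\<close> into the potential weight. This offsets the largest
  possible discrepancy between \<open>V\<close> and \<open>- t * U\<close>, so that weight dominates
  the BS weight at \<open>L * t\<close>.\<close>

lemma crit_imp_BS_crit:
  assumes \<epsilon>: "0 < \<epsilon>" "\<epsilon> < 1"
    and V: "\<And>x n. \<lbrakk>x \<in> X; 1 \<le> n\<rbrakk> \<Longrightarrow> \<bar>V n x + t * U n x\<bar> \<le> real n * \<delta>"
    and less: "crit \<epsilon> V / ereal (ln (1 / \<epsilon>)) < ereal (- \<delta>)"
  shows "BS_crit \<epsilon> U / ereal (ln (1 / \<epsilon>)) \<le> ereal t"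
proof -
  define L where "L = ln (1 / \<epsilon>)"
  have L: "0 < L" using \<epsilon> by (simp add: L_def)
  have "crit \<epsilon> V < ereal (L * - \<delta>)"
    using less L unfolding L_def[symmetric] by (simp add: ereal_divide_less_pos)
  then obtain s where s: "\<Phi> \<epsilon> (weight \<epsilon> V s) = 0" and st: "s < L * - \<delta>"
    unfolding crit_def INF_less_iff by auto
  have "\<Phi> \<epsilon> (BS_weight U (L * t)) = 0"
  proof (rule zero_mono[OF s])
    fix x :: 'a and n :: nat assume x: "x \<in> X" "1 \<le> n"
    have "L * (- t * U n x - real n * \<delta>) \<le> L * V n x"
      using V[OF x] L by (intro mult_left_mono) auto
    moreover have "real n * s \<le> real n * (L * - \<delta>)"
      using st by (intro mult_left_mono) auto
    ultimately show "BS_weight U (L * t) (x, n) \<le> weight \<epsilon> V s (x, n)"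
      by (simp add: weight_def BS_weight_def L_def algebra_simps)
  qed
  then have "BS_crit \<epsilon> U \<le> ereal (L * t)"
    unfolding BS_crit_def by (auto intro: INF_lower2)
  then show ?thesis
    using L unfolding L_def[symmetric] by (simp add: ereal_divide_le_pos)
qed

end

section \<open>The Bowen equation\<close>

text \<open>\<open>S\<close> models the Birkhoff sums, \<open>A\<close> the balls in the potential
  weight and \<open>B\<close> those in the BS weight. They are kept apart because packings take
  closed balls for the former and open balls for the latter. \<open>variation\<close> is uniform
  continuity of the potential summed along orbits, hence linear in \<open>n\<close>.\<close>

locale bowen_equation = critical_exponent \<Phi> X
  for \<Phi> :: "real \<Rightarrow> ('a \<times> nat \<Rightarrow> ennreal) \<Rightarrow> ennreal" and X :: "'a set" +
  fixes S :: "nat \<Rightarrow> 'a \<Rightarrow> real" and A B :: "real \<Rightarrow> nat \<Rightarrow> 'a \<Rightarrow> 'a set" and m M :: real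
  assumes centre: "\<lbrakk>x \<in> X; 1 \<le> n; 0 < \<epsilon>\<rbrakk> \<Longrightarrow> x \<in> A \<epsilon> n x \<and> x \<in> B \<epsilon> n x"
    and subset: "A \<epsilon> n x \<subseteq> X" "B \<epsilon> n x \<subseteq> X"
    and m_pos: "0 < m"
    and S_bounds: "x \<in> X \<Longrightarrow> real n * m \<le> S n x" "x \<in> X \<Longrightarrow> S n x \<le> real n * M"
    and variation: "0 < \<eta> \<Longrightarrow> \<forall>\<^sub>F \<epsilon> in at_right 0. \<forall>x\<in>X. \<forall>n\<ge>1. \<forall>y\<in>A \<epsilon> n x \<union> B \<epsilon> n x.
      \<bar>S n y - S n x\<bar> \<le> real n * \<eta>"
begin

definition V :: "real \<Rightarrow> real \<Rightarrow> nat \<Rightarrow> 'a \<Rightarrow> real" where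
  "V t \<epsilon> n x = (SUP y\<in>A \<epsilon> n x. - t * S n y)"

definition U :: "real \<Rightarrow> nat \<Rightarrow> 'a \<Rightarrow> real" where
  "U \<epsilon> n x = (SUP y\<in>B \<epsilon> n x. S n y)"

definition G :: "real \<Rightarrow> ereal" where
  "G t = Limsup (at_right 0) (\<lambda>\<epsilon>. crit \<epsilon> (V t \<epsilon>) / ereal (ln (1 / \<epsilon>)))"

definition T :: ereal where
  "T = Limsup (at_right 0) (\<lambda>\<epsilon>. BS_crit \<epsilon> (U \<epsilon>) / ereal (ln (1 / \<epsilon>)))"

section \<open>Suprema over a ball compared with the value at its centre\<close>

lemma bdd: "bdd_above ((\<lambda>y. - t * S n y) ` A \<epsilon> n x)" "bdd_above (S n ` B \<epsilon> n x)"
proof -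
  have "\<bar>S n y\<bar> \<le> real n * M" if "y \<in> X" for y
    using S_bounds[OF that, of n] m_pos mult_nonneg_nonneg[of "real n" m] by linarith
  then have "- t * S n y \<le> \<bar>t\<bar> * (real n * M)" if "y \<in> X" for y
    using that by (metis abs_ge_self abs_mult abs_minus_cancel abs_ge_zero mult_left_mono order_trans)
  then show "bdd_above ((\<lambda>y. - t * S n y) ` A \<epsilon> n x)"
    using subset(1)[of \<epsilon> n x] by (intro bdd_aboveI[of _ "\<bar>t\<bar> * (real n * M)"]) auto
  show "bdd_above (S n ` B \<epsilon> n x)"
    using subset(2)[of \<epsilon> n x] S_bounds(2)[of _ n] by (intro bdd_aboveI[of _ "real n * M"]) auto
qed

lemma V_le:
  assumes x: "x \<in> X" "1 \<le> n" "0 < \<epsilon>"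
    and le: "\<And>y. y \<in> X \<Longrightarrow> - t * S n y \<le> - t' * S n y + c"
  shows "V t \<epsilon> n x \<le> V t' \<epsilon> n x + c"
  unfolding V_def
proof (rule cSUP_least)
  show "A \<epsilon> n x \<noteq> {}" using centre[OF x] by blast
  fix y assume y: "y \<in> A \<epsilon> n x"
  then have "- t * S n y \<le> - t' * S n y + c" using le subset(1) by blast
  also have "- t' * S n y \<le> (SUP y\<in>A \<epsilon> n x. - t' * S n y)"
    using y bdd(1) by (rule cSUP_upper)
  finally show "- t * S n y \<le> (SUP y\<in>A \<epsilon> n x. - t' * S n y) + c" by simp
qed

lemma U_nonneg:
  assumes x: "x \<in> X" "1 \<le> n" "0 < \<epsilon>"
  shows "0 \<le> U \<epsilon> n x"
proof -
  have "0 \<le> S n x" using S_bounds(1)[OF x(1), of n] m_pos mult_nonneg_nonneg[of "real n" m] by linarith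
  also have "S n x \<le> U \<epsilon> n x" unfolding U_def using centre[OF x] bdd(2) by (intro cSUP_upper) auto
  finally show ?thesis .
qed

text \<open>Both \<open>V t \<epsilon> n x\<close> and \<open>- t * U \<epsilon> n x\<close> lie
  within \<open>\<bar>t\<bar> * (real n * \<eta>)\<close> of the central value
  \<open>- t * S n x\<close>; the triangle inequality gives the factor 2.\<close>

lemma V_approx:
  assumes x: "x \<in> X" "1 \<le> n" "0 < \<epsilon>"
    and var: "\<And>y. y \<in> A \<epsilon> n x \<union> B \<epsilon> n x \<Longrightarrow> \<bar>S n y - S n x\<bar> \<le> real n * \<eta>"
  shows "\<bar>V t \<epsilon> n x + t * U \<epsilon> n x\<bar> \<le> real n * (2 * \<bar>t\<bar> * \<eta>)"
proof -
  have c: "x \<in> A \<epsilon> n x" "x \<in> B \<epsilon> n x" using centre[OF x] by auto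
  have "U \<epsilon> n x \<le> S n x + real n * \<eta>"
    unfolding U_def using c var by (intro cSUP_least) (fastforce simp: abs_le_iff)+
  moreover have "S n x \<le> U \<epsilon> n x"
    unfolding U_def using c bdd(2) by (intro cSUP_upper) auto
  ultimately have "\<bar>U \<epsilon> n x - S n x\<bar> \<le> real n * \<eta>" by linarith
  then have "\<bar>t * (U \<epsilon> n x - S n x)\<bar> \<le> \<bar>t\<bar> * (real n * \<eta>)"
    unfolding abs_mult by (intro mult_left_mono) auto
  moreover have "V t \<epsilon> n x \<le> - t * S n x + \<bar>t\<bar> * (real n * \<eta>)"
    unfolding V_def
  proof (rule cSUP_least)
    fix y assume "y \<in> A \<epsilon> n x"
    then have "\<bar>t * (S n x - S n y)\<bar> \<le> \<bar>t\<bar> * (real n * \<eta>)"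
      unfolding abs_mult using var[of y] by (intro mult_left_mono) auto
    then show "- t * S n y \<le> - t * S n x + \<bar>t\<bar> * (real n * \<eta>)"
      by (simp add: right_diff_distrib)
  qed (use c in auto)
  moreover have "- t * S n x \<le> V t \<epsilon> n x"
    unfolding V_def using c bdd(1) by (intro cSUP_upper) auto
  ultimately show ?thesis by (simp add: algebra_simps abs_le_iff)
qed

lemma eventually_V_approx:
  assumes "0 < \<delta>"
  shows "\<forall>\<^sub>F \<epsilon> in at_right 0. 0 < \<epsilon> \<and> \<epsilon> < 1 \<and>
    (\<forall>x\<in>X. \<forall>n\<ge>1. \<bar>V t \<epsilon> n x + t * U \<epsilon> n x\<bar> \<le> real n * \<delta>)"
proof -
  \<comment> \<open>The \<open>+ 1\<close> keeps the denominator positive at \<open>t = 0\<close>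
    while still giving \<open>2 * \<bar>t\<bar> * \<eta> \<le> \<delta>\<close>.\<close>
  define \<eta> where "\<eta> = \<delta> / (2 * \<bar>t\<bar> + 1)"
  have \<eta>: "0 < \<eta>" "2 * \<bar>t\<bar> * \<eta> \<le> \<delta>" using assms by (auto simp: \<eta>_def field_simps)
  have "\<forall>\<^sub>F \<epsilon>::real in at_right 0. \<epsilon> \<in> {0<..<1}" by (rule eventually_at_right_real) simp
  with variation[OF \<eta>(1)] show ?thesis
  proof eventually_elim
    case (elim \<epsilon>)
    have "\<bar>V t \<epsilon> n x + t * U \<epsilon> n x\<bar> \<le> real n * \<delta>" if "x \<in> X" "1 \<le> n" for x n
    proof -
      have "\<bar>V t \<epsilon> n x + t * U \<epsilon> n x\<bar> \<le> real n * (2 * \<bar>t\<bar> * \<eta>)"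
        using that elim by (intro V_approx) auto
      also have "\<dots> \<le> real n * \<delta>" using \<eta>(2) by (intro mult_left_mono) auto
      finally show ?thesis .
    qed
    then show ?case using elim by auto
  qed
qed

section \<open>Slope bounds and signs of \<open>G\<close>\<close>

lemma G_shift:
  assumes "\<And>n y. y \<in> X \<Longrightarrow> - t * S n y \<le> - t' * S n y + real n * c"
  shows "G t \<le> G t' + ereal c"
proof -
  have "G t \<le> Limsup (at_right 0) (\<lambda>\<epsilon>. crit \<epsilon> (V t' \<epsilon>) / ereal (ln (1 / \<epsilon>)) + ereal c)"
    unfolding G_def
  proof (rule Limsup_mono)
    have "\<forall>\<^sub>F \<epsilon>::real in at_right 0. \<epsilon> \<in> {0<..<1}" by (rule eventually_at_right_real) simp
    then show "\<forall>\<^sub>F \<epsilon> in at_right 0. crit \<epsilon> (V t \<epsilon>) / ereal (ln (1 / \<epsilon>))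
        \<le> crit \<epsilon> (V t' \<epsilon>) / ereal (ln (1 / \<epsilon>)) + ereal c"
      by eventually_elim (intro crit_shift V_le assms; simp)
  qed
  also have "\<dots> = G t' + ereal c"
    unfolding G_def by (rule Limsup_add_ereal_right) auto
  finally show ?thesis .
qed

text \<open>The lower bound \<open>real n * m\<close> on \<open>S n\<close> enters here. The
  resulting strict decrease makes \<open>T\<close> finite and the root unique.\<close>

lemma G_decreasing:
  assumes "t \<le> t'"
  shows "G t' \<le> G t + ereal (- (t' - t) * m)"
proof (rule G_shift)
  fix n y assume "y \<in> X"
  then have "(t' - t) * (real n * m) \<le> (t' - t) * S n y"
    using assms S_bounds by (intro mult_left_mono) auto
  then show "- t' * S n y \<le> - t * S n y + real n * (- (t' - t) * m)"
    by (simp add: algebra_simps)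
qed

text \<open>The upper bound \<open>real n * M\<close> on \<open>S n\<close> limits how fast
  \<open>G\<close> can fall, which yields finiteness of \<open>G\<close> and its continuity.\<close>

lemma G_Lipschitz:
  assumes "t \<le> t'"
  shows "G t \<le> G t' + ereal ((t' - t) * M)"
proof (rule G_shift)
  fix n y assume "y \<in> X"
  then have "(t' - t) * S n y \<le> (t' - t) * (real n * M)"
    using assms S_bounds by (intro mult_left_mono) auto
  then show "- t * S n y \<le> - t' * S n y + real n * ((t' - t) * M)"
    by (simp add: algebra_simps)
qed

lemma G_0_nonneg: "0 \<le> G 0"
proof -
  have "\<forall>\<^sub>F \<epsilon>::real in at_right 0. \<epsilon> \<in> {0<..<1}" by (rule eventually_at_right_real) simp
  then have "\<forall>\<^sub>F \<epsilon> in at_right 0. 0 \<le> crit \<epsilon> (V 0 \<epsilon>) / ereal (ln (1 / \<epsilon>))"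
  proof eventually_elim
    case (elim \<epsilon>)
    have "V 0 \<epsilon> n x = 0" if "x \<in> X" "1 \<le> n" for x n
    proof -
      \<comment> \<open>The supremum of the constant 0 is 0 only over a nonempty set.\<close>
      have "A \<epsilon> n x \<noteq> {}" using centre[OF that, of \<epsilon>] elim by auto
      then show ?thesis by (simp add: V_def)
    qed
    then show ?case
      using elim by (intro ereal_divide_right_mono[of 0, simplified] crit_nonneg) auto
  qed
  then show ?thesis
    unfolding G_def by (intro le_Limsup) auto
qed

text \<open>For small \<open>\<epsilon>\<close> the BS quotient stays below \<open>t\<close>, so the
  comparison bounds the quotient for \<open>V t\<close> by any prescribed error
  \<open>\<delta> > 0\<close>.\<close>

lemma G_nonpos:
  assumes "T < ereal t"
  shows "G t \<le> 0"
proof (rule ereal_le_epsilon2)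
  fix \<delta> :: real assume "0 < \<delta>"
  from eventually_V_approx[OF this, of t] Limsup_lessD[OF assms[unfolded T_def]]
  have "\<forall>\<^sub>F \<epsilon> in at_right 0. crit \<epsilon> (V t \<epsilon>) / ereal (ln (1 / \<epsilon>)) \<le> ereal \<delta>"
    by eventually_elim (rule BS_crit_imp_crit[where U = "U _" and t = t]; auto intro: U_nonneg)
  then show "G t \<le> 0 + ereal \<delta>"
    unfolding G_def by (simp add: Limsup_bounded)
qed

text \<open>By contradiction: a gap between \<open>G t\<close> and 0 is itself an admissible error
  \<open>\<delta> = - r\<close>, and the converse comparison then forces
  \<open>T \<le> ereal t\<close>.\<close>

lemma G_nonneg:
  assumes "ereal t < T"
  shows "0 \<le> G t"
proof (rule ccontr)
  assume "\<not> 0 \<le> G t"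
  then obtain r where r: "G t < ereal r" "r < 0" using ereal_dense2[of "G t" 0] by force
  then have "0 < - r" by simp
  from eventually_V_approx[OF this, of t] Limsup_lessD[OF r(1)[unfolded G_def]]
  have "\<forall>\<^sub>F \<epsilon> in at_right 0. BS_crit \<epsilon> (U \<epsilon>) / ereal (ln (1 / \<epsilon>)) \<le> ereal t"
    by eventually_elim (rule crit_imp_BS_crit[where V = "V t _" and \<delta> = "- r"]; auto)
  then have "T \<le> ereal t" unfolding T_def by (rule Limsup_bounded)
  with assms show False by simp
qed

text \<open>\<open>G\<close> is nonnegative to the left of \<open>T\<close> and nonpositive to the
  right. Once \<open>T\<close> is known to be finite, continuity turns this change of sign into a
  root at \<open>T\<close>.\<close>

theorem unique_root:
  assumes "G 0 < \<infinity>"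
  shows "\<exists>t. T = ereal t \<and> G t = 0 \<and> (\<forall>s. G s = 0 \<longrightarrow> s = t)"
proof -
  \<comment> \<open>\<open>G 0\<close> lies in \<open>[0, \<infinity>)\<close>, and the two slope
    bounds confine \<open>G t\<close> to a bounded distance from it.\<close>
  have fin: "\<bar>G t\<bar> \<noteq> \<infinity>" for t
  proof (cases "0 \<le> t")
    case True
    then show ?thesis
      using G_decreasing[OF True] G_Lipschitz[OF True] G_0_nonneg assms
      by (cases "G t"; cases "G 0") auto
  next
    case False
    then have "t \<le> 0" by simp
    from G_decreasing[OF this] G_Lipschitz[OF this] G_0_nonneg assms
    show ?thesis by (cases "G t"; cases "G 0") auto
  qed
  define g where "g t = real_of_ereal (G t)" for t
  have G: "G t = ereal (g t)" for t using fin by (simp add: g_def ereal_real')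
  have dec: "g t' + (t' - t) * m \<le> g t" if "t \<le> t'" for t t'
    using G_decreasing[OF that] by (simp add: G algebra_simps)
  have lip: "g t \<le> g t' + (t' - t) * M" if "t \<le> t'" for t t'
    using G_Lipschitz[OF that] by (simp add: G)
  have g0: "0 \<le> g 0" using G_0_nonneg by (simp add: G)
  have above: "g t \<le> 0" if "T < ereal t" for t using G_nonpos[OF that] by (simp add: G)
  have below: "0 \<le> g t" if "ereal t < T" for t using G_nonneg[OF that] by (simp add: G)
  have "T \<noteq> \<infinity>"
  proof
    assume "T = \<infinity>"
    \<comment> \<open>The point is chosen so that decreasing at rate \<open>m\<close> from
      \<open>g 0\<close> brings \<open>g\<close> down to at most \<open>- m < 0\<close>.\<close>
    then have "0 \<le> g (g 0 / m + 1)" by (intro below) simp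
    moreover have "g (g 0 / m + 1) + (g 0 / m + 1) * m \<le> g 0"
      using dec[of 0 "g 0 / m + 1"] g0 m_pos by simp
    moreover have "(g 0 / m + 1) * m = g 0 + m" using m_pos by (simp add: field_simps)
    ultimately show False using m_pos by linarith
  qed
  moreover have "T \<noteq> - \<infinity>"
  proof
    assume "T = - \<infinity>"
    \<comment> \<open>The slope bound gives \<open>g (- 1) \<ge> g 0 + m > 0\<close>, a
      contradiction.\<close>
    then have "g (- 1) \<le> 0" by (intro above) simp
    with dec[of "- 1" 0] g0 m_pos show False by simp
  qed
  ultimately obtain t where t: "T = ereal t" by (cases T) auto
  have cont: "isCont g t"
  proof -
    \<comment> \<open>The absolute value of \<open>M\<close> appears because the locale assumes no
      sign for \<open>M\<close>.\<close>
    have "\<bar>g x - g t\<bar> \<le> \<bar>M\<bar> * \<bar>x - t\<bar>" for x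
    proof (cases "x \<le> t")
      case True
      have "(t - x) * M \<le> (t - x) * \<bar>M\<bar>" using True by (intro mult_left_mono) auto
      moreover have "0 \<le> (t - x) * m" using True m_pos by simp
      ultimately show ?thesis using lip[OF True] dec[OF True] True by (simp add: abs_if mult.commute)
    next
      case False
      then have *: "t \<le> x" by simp
      have "(x - t) * M \<le> (x - t) * \<bar>M\<bar>" using * by (intro mult_left_mono) auto
      moreover have "0 \<le> (x - t) * m" using * m_pos by simp
      ultimately show ?thesis using lip[OF *] dec[OF *] * by (simp add: abs_if mult.commute)
    qed
    moreover have "((\<lambda>x. \<bar>M\<bar> * \<bar>x - t\<bar>) \<longlongrightarrow> 0) (at t)"
      by (auto intro!: tendsto_eq_intros)
    ultimately have "((\<lambda>x. g x - g t) \<longlongrightarrow> 0) (at t)"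
      by (intro Lim_null_comparison[of "\<lambda>x. g x - g t" "\<lambda>x. \<bar>M\<bar> * \<bar>x - t\<bar>"]) auto
    then show ?thesis by (simp add: isCont_def LIM_zero_iff)
  qed
  \<comment> \<open>The sign on each side of \<open>t\<close> passes to \<open>t\<close> itself
    through the one-sided limits of \<open>g\<close>.\<close>
  have "g t \<le> 0"
  proof (rule tendsto_upperbound)
    show "(g \<longlongrightarrow> g t) (at_right t)"
      using cont by (simp add: isCont_def filterlim_at_split)
    show "\<forall>\<^sub>F x in at_right t. g x \<le> 0"
      using eventually_at_right_less by eventually_elim (auto intro: above simp: t)
  qed simp
  moreover have "0 \<le> g t"
  proof (rule tendsto_lowerbound)
    show "(g \<longlongrightarrow> g t) (at_left t)"
      using cont by (simp add: isCont_def filterlim_at_split)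
    have "\<forall>\<^sub>F x in at_left t. x \<in> {t - 1<..<t}" by (rule eventually_at_left_real) simp
    then show "\<forall>\<^sub>F x in at_left t. 0 \<le> g x"
      by eventually_elim (auto intro: below simp: t)
  qed simp
  ultimately have root: "g t = 0" by simp
  have "s = t" if "g s = 0" for s
  proof (rule ccontr)
    assume "s \<noteq> t"
    then consider "s < t" | "t < s" by linarith
    then show False
    proof cases
      case 1
      with dec[of s t] root that mult_pos_pos[of "t - s" m] m_pos show False by linarith
    next
      case 2
      with dec[of t s] root that mult_pos_pos[of "s - t" m] m_pos show False by linarith
    qed
  qed
  then show ?thesis using t root unfolding G ereal_eq_0 by blast
qed

end

section \<open>Coverings and packings by Bowen balls\<close>

text \<open>Starting at \<open>N = 1\<close> keeps pairs \<open>(x, 0)\<close> out of the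
  comparison. Convergence has to be assumed because \<open>lim\<close> is a total operator.\<close>

lemma lim_mono_eventually:
  fixes a b :: "nat \<Rightarrow> ennreal"
  assumes "convergent a" "convergent b" and "\<And>N. 1 \<le> N \<Longrightarrow> a N \<le> b N"
  shows "lim a \<le> lim b"
proof (rule LIMSEQ_le)
  show "a \<longlonglongrightarrow> lim a" "b \<longlonglongrightarrow> lim b"
    using assms(1,2) by (simp_all add: convergent_LIMSEQ_iff)
qed (use assms(3) in blast)

lemma infsum_mono_ennreal:
  fixes v w :: "'b \<Rightarrow> ennreal"
  assumes "\<And>p. p \<in> C \<Longrightarrow> v p \<le> w p"
  shows "infsum v C \<le> infsum w C"
  by (intro infsum_mono nonneg_summable_on_complete assms) auto

lemma le_infsum_ennreal:
  fixes w :: "'b \<Rightarrow> ennreal"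
  assumes "p \<in> C"
  shows "w p \<le> infsum w C"
proof -
  have "infsum w {p} \<le> infsum w C"
    using assms by (intro infsum_mono_neutral nonneg_summable_on_complete) auto
  then show ?thesis by simp
qed

text \<open>Leaving the weight \<open>w\<close> free makes the Bowen and BS quantities two instances
  of one functional; the packing functionals below follow the same pattern.\<close>

definition cover_functional ::
  "'a set \<Rightarrow> ('a \<Rightarrow> 'a) \<Rightarrow> ('a \<Rightarrow> 'a \<Rightarrow> real) \<Rightarrow> 'a set \<Rightarrow> real \<Rightarrow> ('a \<times> nat \<Rightarrow> ennreal) \<Rightarrow> ennreal" where
  "cover_functional X f d Z \<epsilon> w = lim (\<lambda>N. INF C\<in>ball_covers X f d Z N \<epsilon>. infsum w C)"

definition packing_prefunctional ::
  "'a set \<Rightarrow> ('a \<Rightarrow> 'a) \<Rightarrow> ('a \<Rightarrow> 'a \<Rightarrow> real) \<Rightarrow> 'a set \<Rightarrow> real \<Rightarrow> ('a \<times> nat \<Rightarrow> ennreal) \<Rightarrow> ennreal" where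
  "packing_prefunctional X f d Z \<epsilon> w = lim (\<lambda>N. SUP C\<in>ball_packings X f d Z N \<epsilon>. infsum w C)"

definition packing_functional ::
  "'a set \<Rightarrow> ('a \<Rightarrow> 'a) \<Rightarrow> ('a \<Rightarrow> 'a \<Rightarrow> real) \<Rightarrow> 'a set \<Rightarrow> real \<Rightarrow> ('a \<times> nat \<Rightarrow> ennreal) \<Rightarrow> ennreal" where
  "packing_functional X f d Z \<epsilon> w =
     (INF Zs\<in>countable_covers X Z. \<Sum>i. packing_prefunctional X f d (Zs i) \<epsilon> w)"

text \<open>Raising \<open>N\<close> admits fewer covers, so the infima increase and have a limit in
  \<open>ennreal\<close>; for packings the suprema decrease instead.\<close>

lemma convergent_covers: "convergent (\<lambda>N. INF C\<in>ball_covers X f d Z N \<epsilon>. infsum w C :: ennreal)"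
proof (rule convergentI, rule LIMSEQ_SUP, rule incseq_SucI, rule INF_superset_mono)
  show "ball_covers X f d Z (Suc N) \<epsilon> \<subseteq> ball_covers X f d Z N \<epsilon>" for N
    by (fastforce simp: ball_covers_def)
qed simp

lemma convergent_packings: "convergent (\<lambda>N. SUP C\<in>ball_packings X f d Z N \<epsilon>. infsum w C :: ennreal)"
proof (rule convergentI, rule LIMSEQ_INF, rule decseq_SucI, rule SUP_subset_mono)
  show "ball_packings X f d Z (Suc N) \<epsilon> \<subseteq> ball_packings X f d Z N \<epsilon>" for N
    by (fastforce simp: ball_packings_def)
qed simp

lemma cover_functional_mono_set:
  assumes "Z \<subseteq> Z'"
  shows "cover_functional X f d Z \<epsilon> w \<le> cover_functional X f d Z' \<epsilon> w"
  unfolding cover_functional_def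
proof (intro lim_mono_eventually convergent_covers INF_superset_mono)
  show "ball_covers X f d Z' N \<epsilon> \<subseteq> ball_covers X f d Z N \<epsilon>" for N
    using assms by (auto simp: ball_covers_def)
qed simp

lemma packing_functional_mono_set:
  assumes "Z \<subseteq> Z'"
  shows "packing_functional X f d Z \<epsilon> w \<le> packing_functional X f d Z' \<epsilon> w"
  unfolding packing_functional_def
  using assms by (intro INF_superset_mono) (auto simp: countable_covers_def)

text \<open>Nonvanishing: a cover of the nonempty \<open>Z\<close> contains at least one pair, whose
  weight alone contributes 1.\<close>

lemma critical_exponent_cover:
  assumes "Z \<noteq> {}"
  shows "critical_exponent (cover_functional X f d Z) X"
proof
  fix \<epsilon> and w w' :: "'a \<times> nat \<Rightarrow> ennreal"
  assume le: "\<And>x n. \<lbrakk>x \<in> X; 1 \<le> n\<rbrakk> \<Longrightarrow> w (x, n) \<le> w' (x, n)"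
  show "cover_functional X f d Z \<epsilon> w \<le> cover_functional X f d Z \<epsilon> w'"
    unfolding cover_functional_def
  proof (intro lim_mono_eventually convergent_covers INF_superset_mono infsum_mono_ennreal)
    fix N :: nat and C p assume "1 \<le> N" "C \<in> ball_covers X f d Z N \<epsilon>" "p \<in> C"
    then show "w p \<le> w' p" using le[of "fst p" "snd p"] by (force simp: ball_covers_def)
  qed simp
next
  fix \<epsilon> and w :: "'a \<times> nat \<Rightarrow> ennreal"
  assume ge: "\<And>x n. \<lbrakk>x \<in> X; 1 \<le> n\<rbrakk> \<Longrightarrow> 1 \<le> w (x, n)"
  have "1 \<le> (INF C\<in>ball_covers X f d Z N \<epsilon>. infsum w C)" if "1 \<le> N" for N
  proof (rule INF_greatest)
    fix C assume C: "C \<in> ball_covers X f d Z N \<epsilon>"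
    then obtain x n where xn: "(x, n) \<in> C" using assms by (force simp: ball_covers_def)
    with C that have "1 \<le> w (x, n)" by (intro ge) (auto simp: ball_covers_def)
    also have "\<dots> \<le> infsum w C" using xn by (rule le_infsum_ennreal)
    finally show "1 \<le> infsum w C" .
  qed
  then have "lim (\<lambda>N. 1) \<le> cover_functional X f d Z \<epsilon> w"
    unfolding cover_functional_def
    by (intro lim_mono_eventually convergent_covers convergent_const) auto
  then show "cover_functional X f d Z \<epsilon> w \<noteq> 0" by auto
qed

text \<open>Nonvanishing: some member of any countable cover of \<open>Z\<close> is nonempty, and a
  single ball centred in that member is already a packing of weight at least 1.\<close>

lemma critical_exponent_packing:
  assumes "Z \<noteq> {}" "Z \<subseteq> X"
  shows "critical_exponent (packing_functional X f d Z) X"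
proof
  fix \<epsilon> and w w' :: "'a \<times> nat \<Rightarrow> ennreal"
  assume le: "\<And>x n. \<lbrakk>x \<in> X; 1 \<le> n\<rbrakk> \<Longrightarrow> w (x, n) \<le> w' (x, n)"
  have "packing_prefunctional X f d Y \<epsilon> w \<le> packing_prefunctional X f d Y \<epsilon> w'" if "Y \<subseteq> X" for Y
    unfolding packing_prefunctional_def
  proof (intro lim_mono_eventually convergent_packings SUP_subset_mono infsum_mono_ennreal)
    fix N :: nat and C p assume "1 \<le> N" "C \<in> ball_packings X f d Y N \<epsilon>" "p \<in> C"
    then show "w p \<le> w' p" using le[of "fst p" "snd p"] that by (force simp: ball_packings_def)
  qed simp
  then show "packing_functional X f d Z \<epsilon> w \<le> packing_functional X f d Z \<epsilon> w'"
    unfolding packing_functional_def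
    by (intro INF_superset_mono suminf_le) (auto simp: countable_covers_def)
next
  fix \<epsilon> and w :: "'a \<times> nat \<Rightarrow> ennreal"
  assume ge: "\<And>x n. \<lbrakk>x \<in> X; 1 \<le> n\<rbrakk> \<Longrightarrow> 1 \<le> w (x, n)"
  have pre: "1 \<le> packing_prefunctional X f d Y \<epsilon> w" if Y: "Y \<subseteq> X" "x \<in> Y" for Y x
  proof -
    have "1 \<le> (SUP C\<in>ball_packings X f d Y N \<epsilon>. infsum w C)" if "1 \<le> N" for N
    proof (rule SUP_upper2)
      show "{(x, N)} \<in> ball_packings X f d Y N \<epsilon>"
        using Y by (auto simp: ball_packings_def disjoint_family_on_def)
      show "1 \<le> infsum w {(x, N)}" using ge[of x N] Y that by auto
    qed
    then have "lim (\<lambda>N. 1) \<le> packing_prefunctional X f d Y \<epsilon> w"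
      unfolding packing_prefunctional_def
      by (intro lim_mono_eventually convergent_packings convergent_const) auto
    then show ?thesis by simp
  qed
  have "1 \<le> packing_functional X f d Z \<epsilon> w"
    unfolding packing_functional_def
  proof (rule INF_greatest)
    fix Zs assume Zs: "Zs \<in> countable_covers X Z"
    then obtain i x where ix: "x \<in> Zs i" "Zs i \<subseteq> X"
      using assms by (force simp: countable_covers_def)
    have "1 \<le> packing_prefunctional X f d (Zs i) \<epsilon> w" using pre ix by blast
    also have "\<dots> \<le> (\<Sum>i. packing_prefunctional X f d (Zs i) \<epsilon> w)"
      using sum_le_suminf[of "\<lambda>i. packing_prefunctional X f d (Zs i) \<epsilon> w" "{i}"] by simp
    finally show "1 \<le> (\<Sum>i. packing_prefunctional X f d (Zs i) \<epsilon> w)" .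
  qed
  then show "packing_functional X f d Z \<epsilon> w \<noteq> 0" by auto
qed

section \<open>Birkhoff sums on a compact space\<close>

text \<open>Take a Lebesgue number of the cover by preimages of balls of radius
  \<open>\<eta> / 2\<close>: two points at distance below it share one preimage, so their values
  differ by less than \<open>\<eta>\<close>.\<close>

lemma (in Metric_space) compact_uniform_modulus:
  fixes \<phi> :: "'a \<Rightarrow> real"
  assumes "compact_space mtopology" "continuous_map mtopology euclideanreal \<phi>" "0 < \<eta>"
  obtains \<delta> where "0 < \<delta>" "\<And>x y. \<lbrakk>x \<in> M; y \<in> M; d x y < \<delta>\<rbrakk> \<Longrightarrow> \<bar>\<phi> y - \<phi> x\<bar> \<le> \<eta>"
proof -
  define W where "W x = {y \<in> M. \<phi> y \<in> ball (\<phi> x) (\<eta> / 2)}" for x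
  have "openin mtopology (W x)" for x
    using openin_continuous_map_preimage[OF assms(2), of "ball (\<phi> x) (\<eta> / 2)"]
    by (simp add: W_def)
  moreover have "M \<subseteq> \<Union> (W ` M)" using assms(3) by (auto simp: W_def)
  moreover have "compactin mtopology M" using assms(1) by (simp add: compact_space_def)
  ultimately obtain \<delta> where \<delta>: "0 < \<delta>" "\<forall>x\<in>M. \<exists>U\<in>W ` M. mball x \<delta> \<subseteq> U"
    using lebesgue_number[of M "W ` M"] by auto
  show thesis
  proof (rule that[OF \<delta>(1)])
    fix x y assume xy: "x \<in> M" "y \<in> M" "d x y < \<delta>"
    with \<delta>(2) obtain z where "mball x \<delta> \<subseteq> W z" by blast
    moreover have "x \<in> mball x \<delta>" "y \<in> mball x \<delta>" using xy \<delta>(1) by auto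
    ultimately have "x \<in> W z" "y \<in> W z" by blast+
    then show "\<bar>\<phi> y - \<phi> x\<bar> \<le> \<eta>" by (auto simp: W_def dist_real_def abs_if split: if_splits)
  qed
qed

text \<open>Sandwiching \<open>A\<close> and \<open>B\<close> between open and closed Bowen balls
  treats coverings and packings together: the open ball contains the centre, and the closed ball
  controls the variation.\<close>

lemma bowen_equation_birkhoff:
  assumes "TDS X f" "d \<in> compatible_metrics X" "topspace X \<noteq> {}"
    and \<phi>: "continuous_map X euclideanreal \<phi>" "\<And>x. x \<in> topspace X \<Longrightarrow> \<phi> x > 0"
    and \<Phi>: "critical_exponent \<Phi> (topspace X)"
    and A: "\<And>\<epsilon> n x. bowen_ball (topspace X) f d n x \<epsilon> \<subseteq> A \<epsilon> n x"
      "\<And>\<epsilon> n x. A \<epsilon> n x \<subseteq> bowen_cball (topspace X) f d n x \<epsilon>"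
    and B: "\<And>\<epsilon> n x. bowen_ball (topspace X) f d n x \<epsilon> \<subseteq> B \<epsilon> n x"
      "\<And>\<epsilon> n x. B \<epsilon> n x \<subseteq> bowen_cball (topspace X) f d n x \<epsilon>"
  obtains m M where "bowen_equation \<Phi> (topspace X) (birkhoff_sum f \<phi>) A B m M"
proof -
  define Y where "Y = topspace X"
  interpret Metric_space Y d using assms(2) by (simp add: compatible_metrics_def Y_def)
  have top: "mtopology = X" using assms(2) by (simp add: compatible_metrics_def Y_def)
  have comp: "compact_space X" and f: "continuous_map X X f"
    using assms(1) by (auto simp: TDS_def)
  have iter: "(f ^^ j) x \<in> Y" if "x \<in> Y" for j x
    using that f by (induction j) (auto simp: Y_def continuous_map_def)
  have "compact (\<phi> ` Y)"
    using image_compactin[of X "topspace X" euclideanreal \<phi>] comp \<phi>(1)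
    by (simp add: compact_space_def Y_def)
  moreover have "\<phi> ` Y \<noteq> {}" using assms(3) by (simp add: Y_def)
  \<comment> \<open>The minimum of \<open>\<phi>\<close> is attained, so the pointwise positivity of
    \<open>\<phi>\<close> becomes the uniform bound \<open>m = \<phi> a > 0\<close>.\<close>
  ultimately obtain a b where ab: "a \<in> Y" "\<forall>y\<in>Y. \<phi> a \<le> \<phi> y" "\<forall>y\<in>Y. \<phi> y \<le> \<phi> b"
    using compact_attains_inf[of "\<phi> ` Y"] compact_attains_sup[of "\<phi> ` Y"] by auto
  have near: "d ((f ^^ j) x) ((f ^^ j) y) \<le> \<epsilon>"
    if "y \<in> bowen_cball Y f d n x \<epsilon>" "j < n" for x y \<epsilon> n j
  proof -
    have "d ((f ^^ j) x) ((f ^^ j) y) \<le> bowen_dist f d n x y"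
      unfolding bowen_dist_def using that by (intro Max_ge) auto
    with that show ?thesis by (simp add: bowen_cball_def)
  qed
  have centre: "x \<in> bowen_ball Y f d n x \<epsilon>" if "x \<in> Y" "1 \<le> n" "0 < \<epsilon>" for x n \<epsilon>
  proof -
    have zero: "(\<lambda>j. d ((f ^^ j) x) ((f ^^ j) x)) = (\<lambda>j. 0)"
      using mdist_zero[OF iter[OF that(1)]] by (rule ext)
    have "bowen_dist f d n x x = 0"
      unfolding bowen_dist_def zero using that(2) by (subst image_constant[of 0]) auto
    then show ?thesis using that by (simp add: bowen_ball_def)
  qed
  have "bowen_equation \<Phi> Y (birkhoff_sum f \<phi>) A B (\<phi> a) (\<phi> b)"
  proof (intro bowen_equation.intro bowen_equation_axioms.intro)
    show "critical_exponent \<Phi> Y" using \<Phi> by (simp add: Y_def)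
    show "x \<in> A \<epsilon> n x \<and> x \<in> B \<epsilon> n x" if "x \<in> Y" "1 \<le> n" "0 < \<epsilon>" for x n \<epsilon>
      using centre[OF that] A(1)[of n x \<epsilon>] B(1)[of n x \<epsilon>] unfolding Y_def by blast
    show "A \<epsilon> n x \<subseteq> Y" "B \<epsilon> n x \<subseteq> Y" for \<epsilon> n x
      using A(2)[of \<epsilon> n x] B(2)[of \<epsilon> n x] unfolding bowen_cball_def Y_def by blast+
    show "0 < \<phi> a" using ab(1) \<phi>(2) by (simp add: Y_def)
    show "real n * \<phi> a \<le> birkhoff_sum f \<phi> n x" if "x \<in> Y" for n x
      unfolding birkhoff_sum_def
      using sum_bounded_below[of "{..<n}" "\<phi> a" "\<lambda>i. \<phi> ((f ^^ i) x)"] ab(2) iter[OF that] by simp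
    show "birkhoff_sum f \<phi> n x \<le> real n * \<phi> b" if "x \<in> Y" for n x
      unfolding birkhoff_sum_def
      using sum_bounded_above[of "{..<n}" "\<lambda>i. \<phi> ((f ^^ i) x)" "\<phi> b"] ab(3) iter[OF that] by simp
    show "\<forall>\<^sub>F \<epsilon> in at_right 0. \<forall>x\<in>Y. \<forall>n\<ge>1. \<forall>y\<in>A \<epsilon> n x \<union> B \<epsilon> n x.
        \<bar>birkhoff_sum f \<phi> n y - birkhoff_sum f \<phi> n x\<bar> \<le> real n * \<eta>" if \<eta>: "0 < \<eta>" for \<eta>
    proof -
      obtain \<delta> where \<delta>: "0 < \<delta>" "\<And>x y. \<lbrakk>x \<in> Y; y \<in> Y; d x y < \<delta>\<rbrakk> \<Longrightarrow> \<bar>\<phi> y - \<phi> x\<bar> \<le> \<eta>"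
        using compact_uniform_modulus[unfolded top, OF comp \<phi>(1) \<eta>] by blast
      \<comment> \<open>For \<open>\<epsilon> < \<delta>\<close>, points of a closed ball stay
        closer than \<open>\<delta>\<close> to the centre at all times below \<open>n\<close>, so
        each of the \<open>n\<close> summands varies by at most \<open>\<eta>\<close>.\<close>
      show ?thesis
      proof (rule eventually_at_rightI[OF _ \<delta>(1)], intro ballI allI impI)
        fix \<epsilon> x n y assume \<epsilon>: "\<epsilon> \<in> {0<..<\<delta>}" and x: "x \<in> Y" and y: "y \<in> A \<epsilon> n x \<union> B \<epsilon> n x"
        have y': "y \<in> bowen_cball Y f d n x \<epsilon>" 
          unfolding Y_def by (rule subsetD[OF Un_least[OF A(2) B(2)] y])
        then have "y \<in> Y" by (simp add: bowen_cball_def)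
        have "\<bar>birkhoff_sum f \<phi> n y - birkhoff_sum f \<phi> n x\<bar>
            \<le> (\<Sum>i<n. \<bar>\<phi> ((f ^^ i) y) - \<phi> ((f ^^ i) x)\<bar>)"
          unfolding birkhoff_sum_def sum_subtractf[symmetric] by (rule sum_abs)
        also have "\<dots> \<le> real (card {..<n}) * \<eta>"
        proof (rule sum_bounded_above)
          fix i assume "i \<in> {..<n}"
          then show "\<bar>\<phi> ((f ^^ i) y) - \<phi> ((f ^^ i) x)\<bar> \<le> \<eta>"
            using near[OF y', of i] \<epsilon> by (intro \<delta>(2) iter x \<open>y \<in> Y\<close>) simp
        qed
        finally show "\<bar>birkhoff_sum f \<phi> n y - birkhoff_sum f \<phi> n x\<bar> \<le> real n * \<eta>" by simp
      qed
    qed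
  qed
  then show thesis unfolding Y_def by (rule that)
qed

section \<open>Dependence on the set and transfer to the concrete dimensions\<close>

lemma birkhoff_sum_scale: "birkhoff_sum f (\<lambda>x. c * \<phi> x) n y = c * birkhoff_sum f \<phi> n y"
  by (simp add: birkhoff_sum_def sum_distrib_left)

text \<open>This carries finiteness of the dimension from the whole space to \<open>Z\<close>. A
  parameter that annihilates \<open>Z'\<close> also annihilates \<open>Z\<close>, so the infimum for
  \<open>Z\<close> runs over a larger set.\<close>

lemma mdim_eps_mono:
  assumes "Z \<subseteq> Z'"
  shows "mdim_eps X f d Z \<phi> \<epsilon> \<le> mdim_eps X f d Z' \<phi> \<epsilon>"
proof -
  have "bowen_outer X f d Z \<phi> s \<epsilon> \<le> bowen_outer X f d Z' \<phi> s \<epsilon>" for s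
    using cover_functional_mono_set[OF assms]
    unfolding bowen_outer_def bowen_N_def cover_functional_def .
  then show ?thesis
    unfolding mdim_eps_def by (intro INF_superset_mono) (auto simp flip: le_zero_eq intro: order_trans)
qed

lemma Pmdim_eps_mono:
  assumes "Z \<subseteq> Z'"
  shows "Pmdim_eps X f d Z \<phi> \<epsilon> \<le> Pmdim_eps X f d Z' \<phi> \<epsilon>"
proof -
  have "packing_outer X f d Z \<phi> s \<epsilon> \<le> packing_outer X f d Z' \<phi> s \<epsilon>" for s
    using packing_functional_mono_set[OF assms]
    unfolding packing_outer_def packing_pre_def packing_N_def
      packing_functional_def packing_prefunctional_def .
  then show ?thesis
    unfolding Pmdim_eps_def by (intro INF_superset_mono) (auto simp flip: le_zero_eq intro: order_trans)
qed

lemma Limsup_divide_ln_mono: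
  assumes "\<And>\<epsilon>. e \<epsilon> \<le> e' \<epsilon>"
  shows "Limsup (at_right 0) (\<lambda>\<epsilon>. e \<epsilon> / ereal (ln (1 / \<epsilon>)))
    \<le> Limsup (at_right 0) (\<lambda>\<epsilon>. e' \<epsilon> / ereal (ln (1 / \<epsilon>)))"
proof (rule Limsup_mono)
  have "\<forall>\<^sub>F \<epsilon>::real in at_right 0. \<epsilon> \<in> {0<..<1}" by (rule eventually_at_right_real) simp
  then show "\<forall>\<^sub>F \<epsilon> in at_right 0. e \<epsilon> / ereal (ln (1 / \<epsilon>)) \<le> e' \<epsilon> / ereal (ln (1 / \<epsilon>))"
    by eventually_elim (auto intro: ereal_divide_right_mono assms)
qed

theorem theorem1p3:
  fixes X :: "'a topology" and f :: "'a \<Rightarrow> 'a" and d :: "'a \<Rightarrow> 'a \<Rightarrow> real"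
    and Z :: "'a set" and \<phi> :: "'a \<Rightarrow> real"
  assumes "TDS X f"
    and "d \<in> compatible_metrics X"
    and "Z \<noteq> {}" and "Z \<subseteq> topspace X"
    and "continuous_map X euclideanreal \<phi>"
    and "\<And>x. x \<in> topspace X \<Longrightarrow> \<phi> x > 0"
  shows "(mdim (topspace X) f d (topspace X) < \<infinity> \<longrightarrow>
           (\<exists>t::real. BSmdim (topspace X) f d Z \<phi> = ereal t \<and>
              mdim_pot (topspace X) f d Z (\<lambda>x. - t * \<phi> x) = 0 \<and>
              (\<forall>s::real. mdim_pot (topspace X) f d Z (\<lambda>x. - s * \<phi> x) = 0 \<longrightarrow> s = t)))
       \<and> (Pmdim (topspace X) f d (topspace X) < \<infinity> \<longrightarrow>
           (\<exists>t::real. BSPmdim (topspace X) f d Z \<phi> = ereal t \<and>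
              Pmdim_pot (topspace X) f d Z (\<lambda>x. - t * \<phi> x) = 0 \<and>
              (\<forall>s::real. Pmdim_pot (topspace X) f d Z (\<lambda>x. - s * \<phi> x) = 0 \<longrightarrow> s = t)))"
proof (intro conjI impI)
  let ?X = "topspace X"
  have X: "?X \<noteq> {}" using assms(3,4) by auto
  have sub: "bowen_ball ?X f d n x \<epsilon> \<subseteq> bowen_cball ?X f d n x \<epsilon>" for n x \<epsilon>
    by (auto simp: bowen_ball_def bowen_cball_def)
  {
    assume fin: "mdim ?X f d ?X < \<infinity>"
    let ?\<Phi> = "cover_functional ?X f d Z"
    let ?B = "\<lambda>\<epsilon> n x. bowen_ball ?X f d n x \<epsilon>"
    obtain m M where "bowen_equation ?\<Phi> ?X (birkhoff_sum f \<phi>) ?B ?B m M"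
      by (rule bowen_equation_birkhoff[where \<Phi> = ?\<Phi> and A = ?B and B = ?B,
            OF assms(1,2) X assms(5,6) critical_exponent_cover[OF assms(3)]]) (use sub in auto)
    then interpret bowen_equation ?\<Phi> ?X "birkhoff_sum f \<phi>" ?B ?B m M .
    have G: "G t = mdim_pot ?X f d Z (\<lambda>x. - t * \<phi> x)" for t
      unfolding G_def mdim_pot_def crit_def mdim_eps_def bowen_outer_def bowen_N_def
        weight_def V_def cover_functional_def birkhoff_sum_scale ..
    have T: "T = BSmdim ?X f d Z \<phi>"
      unfolding T_def BSmdim_def BS_crit_def BSmdim_eps_def BS_outer_def BS_N_def
        BS_weight_def U_def cover_functional_def ..
    \<comment> \<open>At \<open>t = 0\<close> the potential vanishes, so the assumption on the whole
      space supplies the finiteness of \<open>G 0\<close> required by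
      \<open>unique_root\<close>.\<close>
    have "G 0 = mdim_pot ?X f d Z (\<lambda>_. 0)" by (simp add: G)
    also have "\<dots> \<le> mdim ?X f d ?X"
      unfolding mdim_def mdim_pot_def by (intro Limsup_divide_ln_mono mdim_eps_mono assms(4))
    finally show "\<exists>t. BSmdim ?X f d Z \<phi> = ereal t \<and> mdim_pot ?X f d Z (\<lambda>x. - t * \<phi> x) = 0 \<and>
        (\<forall>s. mdim_pot ?X f d Z (\<lambda>x. - s * \<phi> x) = 0 \<longrightarrow> s = t)"
      using unique_root fin unfolding G T by (meson le_less_trans)
  next
    assume fin: "Pmdim ?X f d ?X < \<infinity>"
    let ?\<Phi> = "packing_functional ?X f d Z"
    \<comment> \<open>Closed balls enter the weight of the potential and open balls the BS weight,
      so here \<open>A\<close> and \<open>B\<close> are different families.\<close>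
    let ?A = "\<lambda>\<epsilon> n x. bowen_cball ?X f d n x \<epsilon>"
    let ?B = "\<lambda>\<epsilon> n x. bowen_ball ?X f d n x \<epsilon>"
    obtain m M where "bowen_equation ?\<Phi> ?X (birkhoff_sum f \<phi>) ?A ?B m M"
      by (rule bowen_equation_birkhoff[where \<Phi> = ?\<Phi> and A = ?A and B = ?B,
            OF assms(1,2) X assms(5,6) critical_exponent_packing[OF assms(3,4)]]) (use sub in auto)
    then interpret bowen_equation ?\<Phi> ?X "birkhoff_sum f \<phi>" ?A ?B m M .
    have G: "G t = Pmdim_pot ?X f d Z (\<lambda>x. - t * \<phi> x)" for t
      unfolding G_def Pmdim_pot_def crit_def Pmdim_eps_def packing_outer_def packing_pre_def
        packing_N_def weight_def V_def packing_functional_def packing_prefunctional_def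
        birkhoff_sum_scale ..
    have T: "T = BSPmdim ?X f d Z \<phi>"
      unfolding T_def BSPmdim_def BS_crit_def BSPmdim_eps_def BSP_outer_def BSP_pre_def BSP_N_def
        BS_weight_def U_def packing_functional_def packing_prefunctional_def ..
    have "G 0 = Pmdim_pot ?X f d Z (\<lambda>_. 0)" by (simp add: G)
    also have "\<dots> \<le> Pmdim ?X f d ?X"
      unfolding Pmdim_def Pmdim_pot_def by (intro Limsup_divide_ln_mono Pmdim_eps_mono assms(4))
    finally show "\<exists>t. BSPmdim ?X f d Z \<phi> = ereal t \<and> Pmdim_pot ?X f d Z (\<lambda>x. - t * \<phi> x) = 0 \<and>
        (\<forall>s. Pmdim_pot ?X f d Z (\<lambda>x. - s * \<phi> x) = 0 \<longrightarrow> s = t)"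
      using unique_root fin unfolding G T by (meson le_less_trans)
  }
qed

end
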